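(* Let $G$ be a finite group. Then the set of supercharacters of the finest normal supercharacter theory of $G$ is $$\{\chi_N\neq 0: N\in N(G)\};$$ that is, $\{\chi^{N^\bullet}\neq 0:N\in N(G)\}=\{\chi_N\neq 0:N\in N(G)\}$.
   Context: $\mathrm{Irr}(G)$ is the set of irreducible complex characters of the finite group $G$, $N(G)$ is the set of all normal subgroups of $G$, $\ker\psi=\{g\in G:\psi(g)=\psi(1)\}$, and $\subset$ denotes strict inclusion. A character is faithful if its kernel is trivial. For $N\in N(G)$: $\mathcal{X}^N:=\{\psi\in\mathrm{Irr}(G):N\subseteq\ker\psi\}$; $\mathcal{X}^{N^\bullet}:=\mathcal{X}^N\setminus\bigcup_{K\in N(G),\,N\subset K}\mathcal{X}^K$; $\chi^{N^\bullet}:=\sum_{\psi\in\mathcal{X}^{N^\bullet}}\psi(1)\psi$ (equal to $0$ if $\mathcal{X}^{N^\bullet}=\emptyset$). The finest normal supercharacter theory of $G$ is the one generated by the set of all normal subgroups of $G$; its supercharacters are the nonzero characters $\chi^{N^\bullet}$, $N\in N(G)$. For $\psi\in\mathrm{Irr}(G)$ with $N\subseteq\ker\psi$, $\overline{\psi}$ is the irreducible character of $G/N$ given by $\overline{\psi}(gN)=\psi(g)$. For $N\in N(G)$, $$\mathcal{X}_N:=\{\psi\in\mathrm{Irr}(G): N\subseteq\ker\psi \text{ and } \overline{\psi}\text{ is a faithful irreducible character of }G/N\},\qquad \chi_N:=\sum_{\psi\in\mathcal{X}_N}\psi(1)\psi .$$ *)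

theory Defs
  imports "HOL-Algebra.Coset" "Jordan_Normal_Form.VS_Connect"
begin

section \<open>Irreducible complex characters\<close>

definition complex_rep :: "('a, 'm) monoid_scheme \<Rightarrow> nat \<Rightarrow> ('a \<Rightarrow> complex mat) \<Rightarrow> bool" where
  "complex_rep G n \<rho> \<longleftrightarrow> \<rho> \<in> hom G (units_of (ring_mat TYPE(complex) n ()))"

definition irreducible_rep :: "('a, 'm) monoid_scheme \<Rightarrow> nat \<Rightarrow> ('a \<Rightarrow> complex mat) \<Rightarrow> bool" where
  "irreducible_rep G n \<rho> \<longleftrightarrow> complex_rep G n \<rho> \<and> n > 0 \<and>
     (\<forall>W. VectorSpace.subspace class_ring W (module_vec TYPE(complex) n) \<longrightarrow>
          (\<forall>g \<in> carrier G. \<forall>w \<in> W. \<rho> g *\<^sub>v w \<in> W) \<longrightarrow>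
          W = {0\<^sub>v n} \<or> W = carrier_vec n)"

text \<open>Characters are total functions on the type of group elements. They take the value 0
  outside the carrier, so that equality of functions is equality of functions on \<open>G\<close>.\<close>

definition char_of_rep :: "('a, 'm) monoid_scheme \<Rightarrow> nat \<Rightarrow> ('a \<Rightarrow> complex mat) \<Rightarrow> 'a \<Rightarrow> complex" where
  "char_of_rep G n \<rho> = (\<lambda>g. if g \<in> carrier G then \<Sum>i<n. \<rho> g $$ (i, i) else 0)"

definition Irr :: "('a, 'm) monoid_scheme \<Rightarrow> ('a \<Rightarrow> complex) set" where
  "Irr G = {char_of_rep G n \<rho> | n \<rho>. irreducible_rep G n \<rho>}"

definition char_ker :: "('a, 'm) monoid_scheme \<Rightarrow> ('a \<Rightarrow> complex) \<Rightarrow> 'a set" where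
  "char_ker G \<psi> = {g \<in> carrier G. \<psi> g = \<psi> \<one>\<^bsub>G\<^esub>}"

definition faithful_char :: "('a, 'm) monoid_scheme \<Rightarrow> ('a \<Rightarrow> complex) \<Rightarrow> bool" where
  "faithful_char G \<psi> \<longleftrightarrow> char_ker G \<psi> = {\<one>\<^bsub>G\<^esub>}"

text \<open>The character of \<open>G/N\<close> that takes the value \<open>\<psi> g\<close> on the coset of \<open>g\<close>. It is used only
  for \<open>N \<subseteq> char_ker G \<psi>\<close>; then \<open>\<psi>\<close> is constant on cosets and \<open>\<psi> ` C\<close> is a singleton.\<close>

definition quot_char ::
    "('a, 'm) monoid_scheme \<Rightarrow> 'a set \<Rightarrow> ('a \<Rightarrow> complex) \<Rightarrow> 'a set \<Rightarrow> complex" where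
  "quot_char G N \<psi> = (\<lambda>C. if C \<in> carrier (G Mod N) then the_elem (\<psi> ` C) else 0)"

definition weighted_char_sum ::
    "('a, 'm) monoid_scheme \<Rightarrow> ('a \<Rightarrow> complex) set \<Rightarrow> 'a \<Rightarrow> complex" where
  "weighted_char_sum G X = (\<lambda>g. sum (\<lambda>\<psi>. \<psi> \<one>\<^bsub>G\<^esub> * \<psi> g) X)"


section \<open>The finest normal supercharacter theory\<close>

definition X_sup :: "('a, 'm) monoid_scheme \<Rightarrow> 'a set \<Rightarrow> ('a \<Rightarrow> complex) set" where
  "X_sup G N = {\<psi> \<in> Irr G. N \<subseteq> char_ker G \<psi>}"

definition X_bullet :: "('a, 'm) monoid_scheme \<Rightarrow> 'a set \<Rightarrow> ('a \<Rightarrow> complex) set" where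
  "X_bullet G N = X_sup G N - (\<Union>K \<in> {K. K \<lhd> G \<and> N \<subset> K}. X_sup G K)"

definition chi_bullet :: "('a, 'm) monoid_scheme \<Rightarrow> 'a set \<Rightarrow> 'a \<Rightarrow> complex" where
  "chi_bullet G N = weighted_char_sum G (X_bullet G N)"

definition finest_normal_supercharacters :: "('a, 'm) monoid_scheme \<Rightarrow> ('a \<Rightarrow> complex) set" where
  "finest_normal_supercharacters G = {chi_bullet G N | N. N \<lhd> G \<and> chi_bullet G N \<noteq> (\<lambda>_. 0)}"

definition X_faithful :: "('a, 'm) monoid_scheme \<Rightarrow> 'a set \<Rightarrow> ('a \<Rightarrow> complex) set" where
  "X_faithful G N = {\<psi> \<in> Irr G. N \<subseteq> char_ker G \<psi> \<and>
     quot_char G N \<psi> \<in> Irr (G Mod N) \<and> faithful_char (G Mod N) (quot_char G N \<psi>)}"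

definition chi_faithful :: "('a, 'm) monoid_scheme \<Rightarrow> 'a set \<Rightarrow> 'a \<Rightarrow> complex" where
  "chi_faithful G N = weighted_char_sum G (X_faithful G N)"

end

theory Submission
  imports Defs "HOL-Algebra.Multiplicative_Group" "Jordan_Normal_Form.Schur_Decomposition"
begin

text \<open>Both \<open>X_bullet G N\<close> and \<open>X_faithful G N\<close> consist of the irreducible characters whose kernel is
  exactly \<open>N\<close>. This rests on the fact that the kernel of a character is the kernel of any
  representation affording it: the eigenvalues of a matrix of finite order are roots of unity, so
  they are all \<open>1\<close> if they add up to the size of the matrix, and a unipotent matrix of
  finite order in characteristic zero is the identity. Hence character kernels are normal, and an
  irreducible representation with \<open>N\<close> in the kernel of its character factors through \<open>G/N\<close>.\<close>

section \<open>Complex matrices of finite order\<close>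

lemma sum_diag_mult_comm:
  fixes A B :: "'a :: comm_semiring_0 mat"
  assumes "A \<in> carrier_mat n m" "B \<in> carrier_mat m n"
  shows "(\<Sum>i<n. (A * B) $$ (i, i)) = (\<Sum>i<m. (B * A) $$ (i, i))"
proof -
  have "(\<Sum>i<n. (A * B) $$ (i, i)) = (\<Sum>i<n. \<Sum>j<m. A $$ (i, j) * B $$ (j, i))"
    using assms by (intro sum.cong) (auto simp: scalar_prod_def atLeast0LessThan)
  also have "\<dots> = (\<Sum>j<m. \<Sum>i<n. B $$ (j, i) * A $$ (i, j))"
    by (subst sum.swap) (simp add: mult.commute)
  also have "\<dots> = (\<Sum>i<m. (B * A) $$ (i, i))"
    using assms by (intro sum.cong) (auto simp: scalar_prod_def atLeast0LessThan)
  finally show ?thesis .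
qed

text \<open>Traces are spelled out as diagonal sums to match \<open>char_of_rep\<close>. Write
  \<open>A\<close> as \<open>P * (B * Q)\<close> and move \<open>P\<close> cyclically to the end;
  then \<open>Q * P\<close> cancels.\<close>

lemma sum_diag_similar:
  fixes A B :: "'a :: comm_semiring_1 mat"
  assumes "A \<in> carrier_mat n n" "similar_mat_wit A B P Q"
  shows "(\<Sum>i<n. A $$ (i, i)) = (\<Sum>i<n. B $$ (i, i))"
proof -
  note w = similar_mat_witD2[OF assms]
  have "(\<Sum>i<n. A $$ (i, i)) = (\<Sum>i<n. (P * (B * Q)) $$ (i, i))"
    using w by (simp add: assoc_mult_mat)
  also have "\<dots> = (\<Sum>i<n. ((B * Q) * P) $$ (i, i))"
    using w by (intro sum_diag_mult_comm) auto
  also have "(B * Q) * P = B"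
    using w by (simp add: assoc_mult_mat[of B n n Q n P n])
  finally show ?thesis .
qed

text \<open>Triangularity kills every term with \<open>k < i\<close> or \<open>j < k\<close>. The
  surviving range is empty below the diagonal and a single index on it, which yields the next two
  lemmas.\<close>

lemma index_mult_upper_triangular:
  fixes A B :: "'a :: semiring_1 mat"
  assumes "A \<in> carrier_mat n n" "B \<in> carrier_mat n n" "upper_triangular A" "upper_triangular B"
    and "i < n" "j < n"
  shows "(A * B) $$ (i, j) = (\<Sum>k=i..j. A $$ (i, k) * B $$ (k, j))"
proof -
  have "(A * B) $$ (i, j) = (\<Sum>k=0..<n. A $$ (i, k) * B $$ (k, j))"
    using assms by (simp add: scalar_prod_def)
  also have "\<dots> = (\<Sum>k=i..j. A $$ (i, k) * B $$ (k, j))"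
  proof (rule sum.mono_neutral_right)
    show "\<forall>k\<in>{0..<n} - {i..j}. A $$ (i, k) * B $$ (k, j) = 0"
    proof
      fix k assume "k \<in> {0..<n} - {i..j}"
      then consider "k < i" | "j < k" "k < n" by force
      then show "A $$ (i, k) * B $$ (k, j) = 0"
        using assms upper_triangularD[of A k i] upper_triangularD[of B j k] by cases auto
    qed
  qed (use assms in auto)
  finally show ?thesis .
qed

lemma upper_triangular_pow:
  fixes A :: "'a :: semiring_1 mat"
  assumes "A \<in> carrier_mat n n" "upper_triangular A"
  shows "upper_triangular (A ^\<^sub>m k)"
proof (induction k)
  case (Suc k)
  show ?case
  proof (rule upper_triangularI)
    fix i j assume "j < i" "i < dim_row (A ^\<^sub>m Suc k)"
    then show "(A ^\<^sub>m Suc k) $$ (i, j) = 0"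
      using assms Suc index_mult_upper_triangular[of "A ^\<^sub>m k" n A i j] by simp
  qed
qed (use assms in auto)

lemma diag_upper_triangular_pow:
  fixes A :: "'a :: semiring_1 mat"
  assumes "A \<in> carrier_mat n n" "upper_triangular A" "i < n"
  shows "(A ^\<^sub>m k) $$ (i, i) = (A $$ (i, i)) ^ k"
proof (induction k)
  case (Suc k)
  then show ?case
    using assms upper_triangular_pow[of A n k] index_mult_upper_triangular[of "A ^\<^sub>m k" n A i i]
    by (simp add: power_commutes)
qed (use assms in auto)

text \<open>Write \<open>U = 1 + E\<close>, where \<open>E\<close> has no entries closer to the
  diagonal than distance \<open>d\<close>. Products of two or more copies of \<open>E\<close> start
  beyond distance \<open>d\<close>, so up to there the power agrees with
  \<open>1 + k E\<close>.\<close>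

lemma first_superdiagonal_unipotent_pow:
  fixes U :: "'a :: comm_ring_1 mat"
  assumes U: "U \<in> carrier_mat n n" "upper_triangular U"
    and diag: "\<And>i. i < n \<Longrightarrow> U $$ (i, i) = 1"
    and zero: "\<And>i j. i < j \<Longrightarrow> j < n \<Longrightarrow> j - i < d \<Longrightarrow> U $$ (i, j) = 0"
    and "i < j" "j < n" "j - i \<le> d"
  shows "(U ^\<^sub>m k) $$ (i, j) = of_nat k * U $$ (i, j)"
  using assms(5-7)
proof (induction k arbitrary: i j)
  case (Suc k)
  let ?V = "U ^\<^sub>m k"
  have "(U ^\<^sub>m Suc k) $$ (i, j) = (\<Sum>l=i..j. ?V $$ (i, l) * U $$ (l, j))"
    using Suc.prems U upper_triangular_pow[OF U] index_mult_upper_triangular[of ?V n U i j] by simp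
  \<comment> \<open>An index strictly between \<open>i\<close> and \<open>j\<close> has distance
    less than \<open>d\<close> from \<open>j\<close>, so \<open>U $$ (l, j)\<close> vanishes. The
    endpoints contribute one and \<open>k\<close> copies of \<open>U $$ (i, j)\<close>.\<close>
  also have "\<dots> = (\<Sum>l\<in>{i, j}. ?V $$ (i, l) * U $$ (l, j))"
  proof (rule sum.mono_neutral_right)
    show "\<forall>l\<in>{i..j} - {i, j}. ?V $$ (i, l) * U $$ (l, j) = 0"
    proof
      fix l assume "l \<in> {i..j} - {i, j}"
      then have "l < j" "j - l < d" using Suc.prems by auto
      with zero[of l j] Suc.prems show "?V $$ (i, l) * U $$ (l, j) = 0" by simp
    qed
  qed (use Suc.prems in auto)
  also have "\<dots> = of_nat (Suc k) * U $$ (i, j)"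
    using Suc diag U diag_upper_triangular_pow[OF U, of i k] by (simp add: algebra_simps)
  finally show ?case .
qed (use U in auto)

text \<open>The superdiagonals are cleared one after another: the first that might be nonzero is
  multiplied by \<open>m\<close> in \<open>U ^\<^sub>m m\<close>, which has to vanish there, and
  \<open>m\<close> is nonzero in characteristic zero.\<close>

lemma unipotent_finite_order_eq_one:
  fixes U :: "'a :: {idom, ring_char_0} mat"
  assumes U: "U \<in> carrier_mat n n" "upper_triangular U"
    and diag: "\<And>i. i < n \<Longrightarrow> U $$ (i, i) = 1"
    and m: "m > 0" "U ^\<^sub>m m = 1\<^sub>m n"
  shows "U = 1\<^sub>m n"
proof -
  have above: "U $$ (i, j) = 0" if "i < j" "j < n" for i j
    using that
  proof (induction "j - i" arbitrary: i j rule: less_induct)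
    case less
    \<comment> \<open>With \<open>d\<close> chosen as \<open>j - i\<close>, the vanishing premise is
      the induction hypothesis.\<close>
    have "(U ^\<^sub>m m) $$ (i, j) = of_nat m * U $$ (i, j)"
      using less by (intro first_superdiagonal_unipotent_pow[OF U diag, of "j - i"]) auto
    then show ?case using m less.prems by simp
  qed
  show ?thesis
  proof (rule eq_matI)
    fix i j assume "i < dim_row (1\<^sub>m n)" "j < dim_col (1\<^sub>m n)"
    then show "U $$ (i, j) = 1\<^sub>m n $$ (i, j)"
      using U diag above by (cases i j rule: linorder_cases) auto
  qed (use U in auto)
qed

text \<open>This is the equality case of the triangle inequality: the nonnegative numbers
  \<open>1 - Re (z j)\<close> add up to 0, so each is 0, and norm 1 leaves no room for an imaginary
  part.\<close>

lemma sum_unit_complex_eq_card: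
  fixes z :: "'a \<Rightarrow> complex"
  assumes "finite A" "\<And>i. i \<in> A \<Longrightarrow> norm (z i) = 1" "sum z A = of_nat (card A)" "i \<in> A"
  shows "z i = 1"
proof -
  have nonneg: "0 \<le> 1 - Re (z j)" if "j \<in> A" for j
    using complex_Re_le_cmod[of "z j"] assms(2)[OF that] by simp
  have "(\<Sum>j\<in>A. 1 - Re (z j)) = real (card A) - Re (sum z A)"
    by (simp add: sum_subtractf)
  then have "(\<Sum>j\<in>A. 1 - Re (z j)) = 0" using assms(3) by simp
  then have Re: "Re (z i) = 1"
    using sum_nonneg_eq_0_iff[OF assms(1), of "\<lambda>j. 1 - Re (z j)"] nonneg assms(4) by simp
  moreover have "(Re (z i))\<^sup>2 + (Im (z i))\<^sup>2 = 1"
    using assms(2)[OF assms(4)] cmod_power2[of "z i"] by simp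
  ultimately show ?thesis by (simp add: complex_eq_iff)
qed

lemma finite_order_mat_eq_one:
  fixes A :: "complex mat"
  assumes A: "A \<in> carrier_mat n n" and m: "m > 0" "A ^\<^sub>m m = 1\<^sub>m n"
    and tr: "(\<Sum>i<n. A $$ (i, i)) = of_nat n"
  shows "A = 1\<^sub>m n"
proof -
  from char_poly_factorized[OF A] obtain es where "char_poly A = (\<Prod>a\<leftarrow>es. [:- a, 1:])"
    by blast
  \<comment> \<open>The characteristic polynomial splits into linear factors, so \<open>A\<close>
    can be triangularised; the diagonal of \<open>B\<close> carries the eigenvalues of
    \<open>A\<close>.\<close>
  from schur_decomposition_exists[OF A this] obtain B P Q where
    B: "upper_triangular B" and wit: "similar_mat_wit A B P Q"
    by (auto simp: similar_mat_def)
  note w = similar_mat_witD2[OF A wit]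
  have wit': "similar_mat_wit B A Q P" by (rule similar_mat_wit_sym[OF wit])
  \<comment> \<open>Conjugation carries the finite order of \<open>A\<close> over to
    \<open>B\<close>, because \<open>Q * P\<close> is the identity.\<close>
  have Bm: "B ^\<^sub>m m = 1\<^sub>m n"
    using similar_mat_wit_pow_id[OF wit', of m] m w by simp
  have "norm (B $$ (i, i)) = 1" if "i < n" for i
  proof -
    have "(B $$ (i, i)) ^ m = 1"
      using diag_upper_triangular_pow[OF w(5) B that, of m] Bm that by simp
    then have "norm (B $$ (i, i)) ^ m = 1" by (simp flip: norm_power)
    then show ?thesis using m(1) power_eq_imp_eq_base[of "norm (B $$ (i, i))" m 1] by simp
  qed
  moreover have "(\<Sum>i<n. B $$ (i, i)) = of_nat n"
    using sum_diag_similar[OF A wit] tr by simp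
  ultimately have "B $$ (i, i) = 1" if "i < n" for i
    using sum_unit_complex_eq_card[of "{..<n}" "\<lambda>i. B $$ (i, i)" i] that by simp
  from unipotent_finite_order_eq_one[OF w(5) B this m(1) Bm] have "B = 1\<^sub>m n" by simp
  then show ?thesis using w by simp
qed

section \<open>Kernels of characters\<close>

text \<open>The units of the matrix ring form the general linear group, so the theory of group
  homomorphisms provides normality of the kernel and factorisation through quotients.\<close>

lemma group_hom_rep:
  assumes "group G" "complex_rep G n \<rho>"
  shows "group_hom G (units_of (ring_mat TYPE(complex) n ())) \<rho>"
proof -
  interpret R: ring "ring_mat TYPE(complex) n ()" by (rule ring_mat)
  show ?thesis
    using assms R.units_group by (simp add: complex_rep_def group_hom_def group_hom_axioms_def)
qed

lemma rep_carrier_mat: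
  assumes "complex_rep G n \<rho>" "g \<in> carrier G"
  shows "\<rho> g \<in> carrier_mat n n"
  using assms by (auto simp: complex_rep_def hom_def units_of_carrier Units_def ring_mat_simps)

lemma rep_one:
  assumes "group G" "complex_rep G n \<rho>"
  shows "\<rho> \<one>\<^bsub>G\<^esub> = 1\<^sub>m n"
  using group_hom.hom_one[OF group_hom_rep[OF assms]] by (simp add: units_of_one ring_mat_simps)

lemma rep_mult:
  assumes "complex_rep G n \<rho>" "g \<in> carrier G" "h \<in> carrier G"
  shows "\<rho> (g \<otimes>\<^bsub>G\<^esub> h) = \<rho> g * \<rho> h"
  using assms by (auto simp: complex_rep_def hom_def units_of_mult ring_mat_simps)

lemma rep_pow:
  assumes "group G" "complex_rep G n \<rho>" "g \<in> carrier G"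
  shows "\<rho> (g [^]\<^bsub>G\<^esub> (k::nat)) = \<rho> g ^\<^sub>m k"
proof -
  interpret group G by fact
  show ?thesis
    using assms rep_one[OF assms(1,2)] rep_carrier_mat[OF assms(2,3)]
    by (induction k) (auto simp: rep_mult[OF assms(2)])
qed

text \<open>The character has value \<open>n\<close> at the identity, so membership in its kernel
  says that \<open>\<rho> g\<close> has trace \<open>n\<close>. As \<open>g\<close> raised to the
  group order is the identity, \<open>\<rho> g\<close> has finite order and
  \<open>finite_order_mat_eq_one\<close> applies.\<close>

lemma char_ker_char_of_rep:
  assumes "group G" "finite (carrier G)" "complex_rep G n \<rho>"
  shows "char_ker G (char_of_rep G n \<rho>) = kernel G (units_of (ring_mat TYPE(complex) n ())) \<rho>"
proof -
  interpret group G by fact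
  have "\<rho> g = 1\<^sub>m n" if g: "g \<in> carrier G" and tr: "(\<Sum>i<n. \<rho> g $$ (i, i)) = of_nat n" for g
  proof (rule finite_order_mat_eq_one[OF rep_carrier_mat[OF assms(3) g] _ _ tr])
    show "0 < Coset.order G" using assms(2) order_gt_0_iff_finite by simp
    show "\<rho> g ^\<^sub>m Coset.order G = 1\<^sub>m n"
      using rep_pow[OF assms(1,3) g, of "Coset.order G"] pow_order_eq_1[OF g] rep_one[OF assms(1,3)]
      by simp
  qed
  then have "(\<Sum>i<n. \<rho> g $$ (i, i)) = of_nat n \<longleftrightarrow> \<rho> g = 1\<^sub>m n" if "g \<in> carrier G" for g
    by (rule iffI) (use that in simp_all)
  moreover have "char_of_rep G n \<rho> \<one>\<^bsub>G\<^esub> = of_nat n"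
    by (simp add: char_of_rep_def rep_one[OF assms(1,3)])
  ultimately show ?thesis
    unfolding char_ker_def kernel_def
    by (intro Collect_cong) (simp add: char_of_rep_def units_of_one ring_mat_simps cong: conj_cong)
qed

lemma normal_char_ker:
  assumes "group G" "finite (carrier G)" "\<psi> \<in> Irr G"
  shows "char_ker G \<psi> \<lhd> G"
proof -
  from assms(3) obtain n \<rho> where "complex_rep G n \<rho>" "\<psi> = char_of_rep G n \<rho>"
    by (auto simp: Irr_def irreducible_rep_def)
  then show ?thesis
    using assms group_hom.normal_kernel[OF group_hom_rep] by (simp add: char_ker_char_of_rep)
qed

section \<open>Characters of quotients\<close>

text \<open>Elements of \<open>N\<close> act as the identity matrix in a representation affording
  \<open>\<psi>\<close>, so both arguments have the same matrix.\<close>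

lemma Irr_constant_on_cosets:
  assumes "group G" "finite (carrier G)" "\<psi> \<in> Irr G" "N \<subseteq> char_ker G \<psi>"
    and "h \<in> N" "g \<in> carrier G"
  shows "\<psi> (h \<otimes>\<^bsub>G\<^esub> g) = \<psi> g"
proof -
  interpret group G by fact
  from assms(3) obtain n \<rho> where r: "complex_rep G n \<rho>" "\<psi> = char_of_rep G n \<rho>"
    by (auto simp: Irr_def irreducible_rep_def)
  have h: "h \<in> carrier G" "\<rho> h = 1\<^sub>m n"
    using assms(4,5) unfolding r(2) char_ker_char_of_rep[OF assms(1,2) r(1)]
    by (auto simp: kernel_def units_of_one ring_mat_simps)
  show ?thesis
    using h assms(6) rep_carrier_mat[OF r(1) assms(6)] rep_mult[OF r(1) h(1) assms(6)]
    by (simp add: r(2) char_of_rep_def)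
qed

lemma quot_char_coset:
  assumes "group G" "finite (carrier G)" "\<psi> \<in> Irr G" "N \<subseteq> char_ker G \<psi>" "N \<lhd> G"
    and g: "g \<in> carrier G"
  shows "quot_char G N \<psi> (N #>\<^bsub>G\<^esub> g) = \<psi> g"
proof -
  interpret normal N G by fact
  have "\<psi> ` (N #>\<^bsub>G\<^esub> g) = {\<psi> g}"
  proof (rule Set.set_eqI)
    fix x
    have "x \<in> \<psi> ` (N #>\<^bsub>G\<^esub> g) \<longleftrightarrow> (\<exists>h\<in>N. x = \<psi> (h \<otimes>\<^bsub>G\<^esub> g))"
      unfolding r_coset_def by blast
    \<comment> \<open>After this step the body no longer depends on \<open>h\<close>, and the
      identity of \<open>G\<close> witnesses that \<open>N\<close> is nonempty.\<close>
    also have "\<dots> \<longleftrightarrow> (\<exists>h\<in>N. x = \<psi> g)"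
      by (rule bex_cong) (simp_all add: Irr_constant_on_cosets[OF assms(1-4) _ g])
    finally show "x \<in> \<psi> ` (N #>\<^bsub>G\<^esub> g) \<longleftrightarrow> x \<in> {\<psi> g}"
      using subgroup.one_closed[OF subgroup_axioms] by blast
  qed
  then show ?thesis using g by (simp add: quot_char_def carrier_FactGroup)
qed

lemma quot_char_Irr:
  assumes "group G" "finite (carrier G)" "\<psi> \<in> Irr G" "N \<subseteq> char_ker G \<psi>" "N \<lhd> G"
  shows "quot_char G N \<psi> \<in> Irr (G Mod N)"
proof -
  from assms(3) obtain n \<rho> where irr: "irreducible_rep G n \<rho>" and \<psi>: "\<psi> = char_of_rep G n \<rho>"
    by (auto simp: Irr_def)
  then have rep: "complex_rep G n \<rho>" by (simp add: irreducible_rep_def)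
  have "N \<subseteq> kernel G (units_of (ring_mat TYPE(complex) n ())) \<rho>"
    using assms(4) by (simp add: \<psi> char_ker_char_of_rep[OF assms(1,2) rep])
  then obtain \<sigma> where hom: "\<sigma> \<in> hom (G Mod N) (units_of (ring_mat TYPE(complex) n ()))"
    and \<sigma>: "\<And>x. x \<in> carrier G \<Longrightarrow> \<sigma> (N #>\<^bsub>G\<^esub> x) = \<rho> x"
    using group_hom.FactGroup_universal_kernel[OF group_hom_rep[OF assms(1) rep] assms(5)] by blast
  \<comment> \<open>The matrices of \<open>\<sigma>\<close> on cosets are exactly those of
    \<open>\<rho>\<close> on elements, so both have the same invariant subspaces.\<close>
  have "irreducible_rep (G Mod N) n \<sigma>"
    using irr hom unfolding irreducible_rep_def complex_rep_def
    by (auto simp: carrier_FactGroup \<sigma>)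
  moreover have "quot_char G N \<psi> = char_of_rep (G Mod N) n \<sigma>"
  proof
    fix C show "quot_char G N \<psi> C = char_of_rep (G Mod N) n \<sigma> C"
    proof (cases "C \<in> carrier (G Mod N)")
      case True
      then obtain g where g: "g \<in> carrier G" "C = N #>\<^bsub>G\<^esub> g" by (auto simp: carrier_FactGroup)
      have "quot_char G N \<psi> C = \<psi> g" using quot_char_coset[OF assms g(1)] g(2) by simp
      then show ?thesis using True g \<sigma>[OF g(1)] by (simp add: \<psi> char_of_rep_def)
    qed (simp add: quot_char_def char_of_rep_def)
  qed
  ultimately show ?thesis by (auto simp: Irr_def)
qed

lemma char_ker_quot_char:
  assumes "group G" "finite (carrier G)" "\<psi> \<in> Irr G" "N \<subseteq> char_ker G \<psi>" "N \<lhd> G"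
  shows "char_ker (G Mod N) (quot_char G N \<psi>) = (\<lambda>g. N #>\<^bsub>G\<^esub> g) ` char_ker G \<psi>"
proof -
  interpret normal N G by fact
  \<comment> \<open>The identity of \<open>G Mod N\<close> is \<open>N\<close> itself, the coset of
    the identity of \<open>G\<close>.\<close>
  have "quot_char G N \<psi> N = \<psi> \<one>\<^bsub>G\<^esub>"
    using quot_char_coset[OF assms one_closed] subset by (simp add: coset_mult_one)
  then have "char_ker (G Mod N) (quot_char G N \<psi>) =
      {C \<in> (\<lambda>g. N #>\<^bsub>G\<^esub> g) ` carrier G. quot_char G N \<psi> C = \<psi> \<one>\<^bsub>G\<^esub>}"
    by (simp add: char_ker_def carrier_FactGroup)
  also have "\<dots> = (\<lambda>g. N #>\<^bsub>G\<^esub> g) `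
      {g \<in> carrier G. quot_char G N \<psi> (N #>\<^bsub>G\<^esub> g) = \<psi> \<one>\<^bsub>G\<^esub>}"
    by blast
  also have "{g \<in> carrier G. quot_char G N \<psi> (N #>\<^bsub>G\<^esub> g) = \<psi> \<one>\<^bsub>G\<^esub>} = char_ker G \<psi>"
    unfolding char_ker_def by (rule Collect_cong) (simp add: quot_char_coset[OF assms] cong: conj_cong)
  finally show ?thesis .
qed

lemma image_eq_singleton_iff:
  assumes "A \<noteq> {}"
  shows "f ` A = {c} \<longleftrightarrow> (\<forall>x\<in>A. f x = c)"
  using assms by auto

text \<open>The kernel of the quotient character is the image of \<open>char_ker G \<psi>\<close>
  under the projection. It is trivial exactly when the projection collapses all of
  \<open>char_ker G \<psi>\<close> to \<open>N\<close>, that is, when this kernel lies in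
  \<open>N\<close>.\<close>

lemma faithful_quot_char_iff:
  assumes "group G" "finite (carrier G)" "\<psi> \<in> Irr G" "N \<subseteq> char_ker G \<psi>" "N \<lhd> G"
  shows "faithful_char (G Mod N) (quot_char G N \<psi>) \<longleftrightarrow> char_ker G \<psi> = N"
proof -
  interpret normal N G by fact
  have ker: "char_ker G \<psi> \<subseteq> carrier G" by (auto simp: char_ker_def)
  have coset: "N #>\<^bsub>G\<^esub> g = N \<longleftrightarrow> g \<in> N" if "g \<in> char_ker G \<psi>" for g
    using coset_join1[OF _ _ subgroup_axioms, of g] coset_join2[OF _ subgroup_axioms, of g]
      subsetD[OF ker that] by blast
  \<comment> \<open>Nonemptiness matters because the image of the empty set would not be the
    singleton \<open>{N}\<close>.\<close>
  have "\<one>\<^bsub>G\<^esub> \<in> char_ker G \<psi>" by (simp add: char_ker_def)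
  then have "char_ker G \<psi> \<noteq> {}" by blast
  have "faithful_char (G Mod N) (quot_char G N \<psi>) \<longleftrightarrow> (\<lambda>g. N #>\<^bsub>G\<^esub> g) ` char_ker G \<psi> = {N}"
    by (simp add: faithful_char_def char_ker_quot_char[OF assms])
  also have "\<dots> \<longleftrightarrow> (\<forall>g\<in>char_ker G \<psi>. N #>\<^bsub>G\<^esub> g = N)"
    using image_eq_singleton_iff[OF \<open>char_ker G \<psi> \<noteq> {}\<close>] .
  also have "\<dots> \<longleftrightarrow> (\<forall>g\<in>char_ker G \<psi>. g \<in> N)"
    by (rule ball_cong[OF refl]) (rule coset)
  also have "\<dots> \<longleftrightarrow> char_ker G \<psi> = N"
    using assms(4) by blast
  finally show ?thesis .
qed

text \<open>If \<open>N\<close> is strictly smaller than the kernel of \<open>\<psi>\<close>, then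
  that kernel, being normal, is itself a \<open>K\<close> that removes \<open>\<psi>\<close>. If
  they are equal, no strictly larger \<open>K\<close> fits inside.\<close>

lemma X_bullet_eq:
  assumes "group G" "finite (carrier G)"
  shows "X_bullet G N = {\<psi> \<in> Irr G. char_ker G \<psi> = N}"
proof (rule Set.set_eqI)
  fix \<psi>
  have "(N \<subseteq> char_ker G \<psi> \<and> (\<forall>K. K \<lhd> G \<and> N \<subset> K \<longrightarrow> \<not> K \<subseteq> char_ker G \<psi>)) \<longleftrightarrow> char_ker G \<psi> = N"
    if "\<psi> \<in> Irr G"
    using normal_char_ker[OF assms that] by blast
  then show "\<psi> \<in> X_bullet G N \<longleftrightarrow> \<psi> \<in> {\<psi> \<in> Irr G. char_ker G \<psi> = N}"
    unfolding X_bullet_def X_sup_def by blast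
qed

text \<open>For \<open>N\<close> inside the kernel, \<open>quot_char_Irr\<close> supplies
  irreducibility and \<open>faithful_quot_char_iff\<close> turns faithfulness into equality;
  conversely, equality gives the inclusion.\<close>

lemma X_faithful_eq:
  assumes "group G" "finite (carrier G)" "N \<lhd> G"
  shows "X_faithful G N = {\<psi> \<in> Irr G. char_ker G \<psi> = N}"
proof (rule Set.set_eqI)
  fix \<psi>
  have "quot_char G N \<psi> \<in> Irr (G Mod N) \<and> faithful_char (G Mod N) (quot_char G N \<psi>)
      \<longleftrightarrow> char_ker G \<psi> = N" if "\<psi> \<in> Irr G" "N \<subseteq> char_ker G \<psi>"
    using quot_char_Irr[OF assms(1,2) that assms(3)] faithful_quot_char_iff[OF assms(1,2) that assms(3)]
    by simp
  then show "\<psi> \<in> X_faithful G N \<longleftrightarrow> \<psi> \<in> {\<psi> \<in> Irr G. char_ker G \<psi> = N}"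
    unfolding X_faithful_def by blast
qed

theorem proposition4p6:
  fixes G :: "('a, 'm) monoid_scheme"
  assumes "group G" and "finite (carrier G)"
  shows "finest_normal_supercharacters G =
    {chi_faithful G N | N. N \<lhd> G \<and> chi_faithful G N \<noteq> (\<lambda>_. 0)}"
proof -
  \<comment> \<open>For each normal \<open>N\<close> both sums run over the irreducible characters
    with kernel \<open>N\<close>, so the two families agree term by term.\<close>
  have "chi_bullet G N = chi_faithful G N" if "N \<lhd> G" for N
    using that assms by (simp add: chi_bullet_def chi_faithful_def X_bullet_eq X_faithful_eq)
  then show ?thesis
    unfolding finest_normal_supercharacters_def by (metis (lifting))
qed

end
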